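(* Let $T$ be a tree (of order at least $2$) that is not a star. Then $\gamma_{t2}(T)\leq 2\gamma(T)-1$. Moreover, $\gamma_{t2}(T)=2\gamma(T)-1$ if and only if there is a labeling $S$ of $T$ such that $(T,S)\in\mathscr{T}$.
   Context: $\gamma(G)$ is the domination number (minimum size of a set $D$ such that every vertex outside $D$ has a neighbor in $D$). A semitotal dominating set of a graph without isolated vertices is a dominating set $S$ in which every vertex of $S$ is at distance at most $2$ from another vertex of $S$; $\gamma_{t2}(G)$ is the minimum size of such a set. A star is $K_{1,n}$, $n\ge1$. A labeling of a tree assigns to each vertex a status in $\{A,B,C,D,E\}$. The family $\mathscr{T}$ of labeled trees is the smallest family that contains the path $P_6=x_1x_2x_3x_4x_5x_6$ labeled with statuses $C,A,D,E,B,C$ respectively, and is closed under the following operations applied to a labeled tree in $\mathscr{T}$ and a vertex $v$ of it (old statuses unchanged): $\mathscr{O}_1$: if $v$ has status $A$ or $B$, add a new vertex $u$ and the edge $uv$, with $u$ of status $C$. $\mathscr{O}_2$: if $v$ has status $A$, add a new path $u_1u_2u_3u_4$ and the edge $u_1v$, with $u_1,u_2,u_3,u_4$ of statuses $D,E,B,C$ respectively. *)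

theory Defs
  imports "Graph_Theory.Graph_Theory"
begin

text \<open>Finite simple graphs are represented by the locale \<open>pair_graph\<close>: an undirected edge
  \<open>uv\<close> is the pair of arcs \<open>(u,v)\<close>, \<open>(v,u)\<close>.\<close>

text \<open>The library predicate \<open>tree\<close> is meant for digraphs whose arcs are not symmetric: it counts
  traversing an edge back and forth as a cycle of length 2. Cycles of a simple graph have length
  at least 3.\<close>
definition is_tree :: "'a pair_pre_digraph \<Rightarrow> bool" where
  "is_tree G \<longleftrightarrow> pair_graph G \<and> Digraph_Component.connected (with_proj G) \<and>
     \<not> (\<exists>p. pre_digraph.cycle (with_proj G) p \<and> 3 \<le> length p)"

definition is_star :: "'a pair_pre_digraph \<Rightarrow> bool" where
  "is_star G \<longleftrightarrow> (\<exists>c L. finite L \<and> L \<noteq> {} \<and> c \<notin> L \<and>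
     pverts G = insert c L \<and> parcs G = {c} \<times> L \<union> L \<times> {c})"

definition graph_dist :: "'a pair_pre_digraph \<Rightarrow> 'a \<Rightarrow> 'a \<Rightarrow> ereal" where
  "graph_dist G u v = wf_digraph.\<mu> (with_proj G) (\<lambda>_. 1) u v"

definition dominating_set :: "'a pair_pre_digraph \<Rightarrow> 'a set \<Rightarrow> bool" where
  "dominating_set G D \<longleftrightarrow> D \<subseteq> pverts G \<and> (\<forall>v \<in> pverts G - D. \<exists>d \<in> D. (v, d) \<in> parcs G)"

definition domination_number :: "'a pair_pre_digraph \<Rightarrow> nat" where
  "domination_number G = Min (card ` {D. dominating_set G D})"

definition semitotal_dominating_set :: "'a pair_pre_digraph \<Rightarrow> 'a set \<Rightarrow> bool" where
  "semitotal_dominating_set G S \<longleftrightarrow> dominating_set G S \<and>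
     (\<forall>u \<in> S. \<exists>v \<in> S. v \<noteq> u \<and> graph_dist G u v \<le> 2)"

text \<open>Meaningful only for finite graphs without isolated vertices; for these the minimum ranges over
  a nonempty set, since the whole vertex set is a semitotal dominating set.\<close>
definition semitotal_domination_number :: "'a pair_pre_digraph \<Rightarrow> nat" where
  "semitotal_domination_number G = Min (card ` {S. semitotal_dominating_set G S})"

datatype status = Status_A | Status_B | Status_C | Status_D | Status_E

definition undirected :: "'a rel \<Rightarrow> 'a rel" where
  "undirected R = R \<union> R\<inverse>"

text \<open>A labeling is a total function, of which only the values on the vertices of the tree matter.
  The new vertices of each operation are arbitrary distinct elements of the vertex type outside the
  current tree, so the family is closed under isomorphism within that type.\<close>
inductive_set labeled_family :: "('a pair_pre_digraph \<times> ('a \<Rightarrow> status)) set" where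
  base: "\<lbrakk>distinct [x1, x2, x3, x4, x5, x6];
      S x1 = Status_C; S x2 = Status_A; S x3 = Status_D;
      S x4 = Status_E; S x5 = Status_B; S x6 = Status_C\<rbrakk>
    \<Longrightarrow> (\<lparr>pverts = {x1, x2, x3, x4, x5, x6},
          parcs = undirected {(x1, x2), (x2, x3), (x3, x4), (x4, x5), (x5, x6)}\<rparr>, S)
        \<in> labeled_family"
| op1: "\<lbrakk>(T, S) \<in> labeled_family; v \<in> pverts T; S v = Status_A \<or> S v = Status_B; u \<notin> pverts T\<rbrakk>
    \<Longrightarrow> (\<lparr>pverts = pverts T \<union> {u}, parcs = parcs T \<union> undirected {(u, v)}\<rparr>,
         S(u := Status_C)) \<in> labeled_family"
| op2: "\<lbrakk>(T, S) \<in> labeled_family; v \<in> pverts T; S v = Status_A;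
      distinct [u1, u2, u3, u4]; {u1, u2, u3, u4} \<inter> pverts T = {}\<rbrakk>
    \<Longrightarrow> (\<lparr>pverts = pverts T \<union> {u1, u2, u3, u4},
          parcs = parcs T \<union> undirected {(u1, v), (u1, u2), (u2, u3), (u3, u4)}\<rparr>,
         S(u1 := Status_D, u2 := Status_E, u3 := Status_B, u4 := Status_C)) \<in> labeled_family"

end

theory Submission
  imports Defs
begin

text \<open>Let \<open>D\<close> be a minimum dominating set of a non-star tree, so \<open>card D \<ge> 2\<close>. Adding a neighbor of
  every vertex of \<open>D\<close> gives a semitotal dominating set of size \<open>2 * card D\<close>, and every vertex of \<open>D\<close>
  has another one within distance 3. Two vertices of \<open>D\<close> at distance 3 can share an added vertex, which
  gives the bound. In case of equality no second saving is possible: distinct vertices of \<open>D\<close> are at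
  distance at least 3, any two pairs at distance 3 intersect, and no triangle of such pairs occurs (it
  would close a cycle of length 9). So the pairs at distance 3 form a star on \<open>D\<close>, and acyclicity forces
  the tree to be a spider: a center \<open>a\<close>, paths \<open>a - p b - q b - b\<close> for the other \<open>b\<close> in \<open>D\<close>, and leaves
  at the vertices of \<open>D\<close>. Each vertex of \<open>D\<close> has a leaf, as otherwise an exchange saves a vertex.
  Conversely, the trees of the family are such spiders, and a semitotal dominating set meets every leg in
  at least two vertices and the center with its leaves in at least one.\<close>

section \<open>Trees and distance at most 2\<close>

text \<open>Edge-level substitute for distance at most 2. In a symmetric graph it also holds for
  \<open>u = v\<close> when \<open>u\<close> has a neighbor, so distinctness is always demanded
  separately.\<close>

definition near :: "'a pair_pre_digraph \<Rightarrow> 'a \<Rightarrow> 'a \<Rightarrow> bool" where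
  "near G u v \<longleftrightarrow> (u, v) \<in> parcs G \<or> (\<exists>w. (u, w) \<in> parcs G \<and> (w, v) \<in> parcs G)"

text \<open>The distance is an infimum of walk lengths, and a walk of length at most 2 between
  distinct vertices is one arc or two consecutive arcs.\<close>

lemma graph_dist_le_2_iff:
  assumes G: "pair_graph G" and "u \<in> pverts G" "u \<noteq> v"
  shows "graph_dist G u v \<le> 2 \<longleftrightarrow> near G u v"
proof -
  interpret pair_graph G by (rule G)
  have cost: "awalk_cost (\<lambda>_. 1) p = length p" for p
    by (simp add: awalk_cost_def sum_list_triv)
  show ?thesis
  proof
    assume near: "near G u v"
    have "\<exists>p. awalk u p v \<and> length p \<le> 2"
    proof (cases "(u, v) \<in> parcs G")
      case True
      then have "awalk u [(u, v)] v" using assms by (auto simp: awalk_def)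
      then show ?thesis by (intro exI[of _ "[(u, v)]"]) simp
    next
      case False
      then obtain w where "(u, w) \<in> parcs G" "(w, v) \<in> parcs G"
        using near by (auto simp: near_def)
      then have "awalk u [(u, w), (w, v)] v" using assms by (auto simp: awalk_def)
      then show ?thesis by (intro exI[of _ "[(u, w), (w, v)]"]) simp
    qed
    then obtain p where p: "awalk u p v" "length p \<le> 2" by blast
    have "graph_dist G u v \<le> ereal (length p)"
      using min_cost_le_walk_cost[OF p(1), of "\<lambda>_. 1"] by (simp add: graph_dist_def cost)
    also have "\<dots> \<le> 2" using p(2) by simp
    finally show "graph_dist G u v \<le> 2" .
  next
    assume le: "graph_dist G u v \<le> 2"
    show "near G u v"
    proof (rule ccontr)
      assume far: "\<not> near G u v"
      have "3 \<le> length p" if "awalk u p v" for p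
      proof (rule ccontr)
        assume "\<not> 3 \<le> length p"
        then consider "p = []" | x y where "p = [(x, y)]" | x y x' y' where "p = [(x, y), (x', y')]"
          by (cases p; cases "tl p"; cases "tl (tl p)") auto
        then show False
          using that far \<open>u \<noteq> v\<close> by cases (auto simp: awalk_def near_def)
      qed
      then have "3 \<le> graph_dist G u v"
        unfolding graph_dist_def \<mu>_def by (intro INF_greatest) (simp add: cost)
      from this le have "(3::ereal) \<le> 2" by (rule order_trans)
      then show False by simp
    qed
  qed
qed

text \<open>Zipping a vertex list with its tail yields the arc list of the walk, so that cycles can
  be given by their vertices.\<close>

lemma awalk_of_verts:
  assumes "successively (\<lambda>u v. (u, v) \<in> E) (u # xs)"
  shows "pcas u (zip (u # xs) xs) (last (u # xs)) \<and> pawalk_verts u (zip (u # xs) xs) = u # xs \<and>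
    set (zip (u # xs) xs) \<subseteq> E"
  using assms by (induction xs arbitrary: u) auto

locale undirected_tree =
  fixes T :: "'a pair_pre_digraph"
  assumes tree: "is_tree T"
begin

abbreviation V where "V \<equiv> pverts T"
abbreviation E where "E \<equiv> parcs T"

lemma pair_graph: "pair_graph T"
  using tree by (simp add: is_tree_def)

lemma finite_V: "finite V"
proof -
  interpret pair_graph T by (rule pair_graph)
  show ?thesis by (rule pair_finite_verts)
qed

lemma E_V: "(u, v) \<in> E \<Longrightarrow> u \<in> V" "(u, v) \<in> E \<Longrightarrow> v \<in> V"
proof -
  interpret pair_graph T by (rule pair_graph)
  show "(u, v) \<in> E \<Longrightarrow> u \<in> V" "(u, v) \<in> E \<Longrightarrow> v \<in> V"
    using in_arcsD1 in_arcsD2 by auto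
qed

lemma E_sym: "(u, v) \<in> E \<Longrightarrow> (v, u) \<in> E"
proof -
  interpret pair_graph T by (rule pair_graph)
  show "(u, v) \<in> E \<Longrightarrow> (v, u) \<in> E" by (rule arcs_symmetric)
qed

lemma E_irrefl: "(u, u) \<notin> E"
proof -
  interpret pair_graph T by (rule pair_graph)
  show ?thesis using no_loops' by blast
qed

lemma near_sym: "near T u v \<Longrightarrow> near T v u"
  unfolding near_def using E_sym by blast

text \<open>Connectedness in the form used below: without such an edge, \<open>X\<close> would be
  closed under reachability.\<close>

lemma cut_edge:
  assumes "s \<in> X" "X \<subseteq> V" "t \<in> V" "t \<notin> X"
  obtains u v where "(u, v) \<in> E" "u \<in> X" "v \<notin> X"
proof -
  interpret pair_graph T by (rule pair_graph)
  have "s \<rightarrow>\<^sup>*\<^bsub>mk_symmetric T\<^esub> t"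
    using tree assms by (auto simp: is_tree_def connected_def strongly_connected_def)
  \<comment> \<open>Connectedness is defined through the symmetric closure, which changes nothing
    here.\<close>
  moreover have "mk_symmetric T = T"
    using arcs_symmetric by (intro pair_pre_digraph.equality) (auto simp: parcs_mk_symmetric)
  ultimately have r: "s \<rightarrow>\<^sup>*\<^bsub>T\<^esub> t" by simp
  have "\<exists>u v. (u, v) \<in> E \<and> u \<in> X \<and> v \<notin> X"
  proof (rule ccontr)
    assume *: "\<nexists>u v. (u, v) \<in> E \<and> u \<in> X \<and> v \<notin> X"
    from r have "t \<in> X" using \<open>s \<in> X\<close>
    proof (induction rule: reachable_induct)
      case (step x y)
      then show ?case using * by auto
    qed 
    then show False using assms by simp
  qed
  then show ?thesis using that by blast
qed

text \<open>Acyclicity for vertex lists. The closed walk has one arc more than \<open>xs\<close> has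
  vertices, so \<open>2 \<le> length xs\<close> matches the bound 3 in
  \<open>is_tree\<close>.\<close>

lemma no_cycle:
  assumes "successively (\<lambda>u v. (u, v) \<in> E) (u # xs @ [u])" "distinct (u # xs)" "2 \<le> length xs"
  shows False
proof -
  interpret pair_graph T by (rule pair_graph)
  let ?ys = "xs @ [u]"
  let ?p = "zip (u # ?ys) ?ys"
  have "u \<in> V" using assms by (cases xs) (auto dest: E_V)
  then have "awalk u ?p u \<and> pawalk_verts u ?p = u # ?ys"
    using awalk_of_verts[OF assms(1)] by (simp add: awalk_def)
  moreover have "length ?p = Suc (length xs)" by simp
  ultimately have "cycle ?p" "3 \<le> length ?p"
    using assms unfolding cycle_def by (auto intro!: exI[of _ u])
  then show False using tree unfolding is_tree_def by blast
qed

end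

section \<open>The upper bound\<close>

context undirected_tree begin

lemma semitotal_dominating_set_iff:
  "semitotal_dominating_set T S \<longleftrightarrow> dominating_set T S \<and> (\<forall>u\<in>S. \<exists>v\<in>S. v \<noteq> u \<and> near T u v)"
  unfolding semitotal_dominating_set_def
  using graph_dist_le_2_iff[OF pair_graph] by (metis dominating_set_def subsetD)

lemma finite_dominating_set: "dominating_set T D \<Longrightarrow> finite D"
  using finite_V finite_subset by (auto simp: dominating_set_def)

lemma finite_dominating_sets: "finite {D. dominating_set T D}"
  by (rule finite_subset[of _ "Pow V"]) (auto simp: dominating_set_def finite_V)

lemma finite_semitotal_dominating_sets: "finite {S. semitotal_dominating_set T S}"
  by (rule finite_subset[OF _ finite_dominating_sets]) (auto simp: semitotal_dominating_set_def)

lemma domination_number_le: "dominating_set T D \<Longrightarrow> domination_number T \<le> card D"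
  unfolding domination_number_def using finite_dominating_sets by (intro Min_le) auto

lemma semitotal_domination_number_le:
  "semitotal_dominating_set T S \<Longrightarrow> semitotal_domination_number T \<le> card S"
  unfolding semitotal_domination_number_def using finite_semitotal_dominating_sets
  by (intro Min_le) auto

lemma minimum_dominating_set:
  obtains D where "dominating_set T D" "card D = domination_number T"
proof -
  have "dominating_set T V" by (simp add: dominating_set_def)
  then have "domination_number T \<in> card ` {D. dominating_set T D}"
    unfolding domination_number_def using finite_dominating_sets by (intro Min_in) auto
  then show ?thesis using that by auto
qed

end

locale nontrivial_tree = undirected_tree +
  assumes card_V: "2 \<le> card (pverts T)"
begin

lemma has_neighbor:
  assumes "v \<in> V"
  shows "\<exists>w. (v, w) \<in> E"
proof -
  obtain t where "t \<in> V" "t \<noteq> v"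
    using card_V assms by (metis card_le_Suc0_iff_eq finite_V not_less_eq_eq numeral_2_eq_2)
  then obtain x y where "(x, y) \<in> E" "x \<in> {v}"
    using cut_edge[of v "{v}" t] assms by blast
  then show ?thesis by blast
qed

lemma minimum_semitotal_dominating_set:
  obtains S where "semitotal_dominating_set T S" "card S = semitotal_domination_number T"
proof -
  have "semitotal_dominating_set T V"
    unfolding semitotal_dominating_set_iff dominating_set_def near_def
    using has_neighbor E_V E_irrefl by auto metis
  then have "semitotal_domination_number T \<in> card ` {S. semitotal_dominating_set T S}"
    unfolding semitotal_domination_number_def using finite_semitotal_dominating_sets
    by (intro Min_in) auto
  then show ?thesis using that by auto
qed

text \<open>Every vertex of \<open>D - C\<close> is given a private neighbor as its witness, so each vertex of \<open>C\<close>
  that is served by \<open>D\<close> or by a shared witness in \<open>Y\<close> saves one vertex over \<open>2 * card D\<close>.\<close>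
lemma semitotal_domination_number_saving:
  assumes D: "dominating_set T D" and C: "C \<subseteq> D" and Y: "Y \<subseteq> V" "finite Y"
    and wC: "\<And>c. c \<in> C \<Longrightarrow> \<exists>y\<in>D \<union> Y. y \<noteq> c \<and> near T c y"
    and wY: "\<And>y. y \<in> Y \<Longrightarrow> \<exists>d\<in>D. d \<noteq> y \<and> near T y d"
  shows "semitotal_domination_number T + card C \<le> 2 * card D + card Y"
proof -
  have finD: "finite D" using D by (rule finite_dominating_set)
  have "\<forall>d\<in>D. \<exists>w. (d, w) \<in> E" using D has_neighbor by (auto simp: dominating_set_def)
  then obtain h where h: "(d, h d) \<in> E" if "d \<in> D" for d by metis
  let ?S = "D \<union> Y \<union> h ` (D - C)"
  have "\<exists>v\<in>?S. v \<noteq> u \<and> near T u v" if u: "u \<in> ?S" for u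
  proof -
    consider "u \<in> C" | "u \<in> Y" | "u \<in> D - C" | d where "d \<in> D - C" "u = h d"
      using u by blast
    then show ?thesis
    proof cases
      case 1 then show ?thesis using wC[of u] by blast
    next
      case 2 then show ?thesis using wY[of u] by blast
    next
      case 3
      then have "h u \<noteq> u" "near T u (h u)" using h[of u] E_irrefl by (auto simp: near_def)
      then show ?thesis using 3 by blast
    next
      case 4
      then have "d \<noteq> u" "near T u d" using h[of d] E_irrefl E_sym by (auto simp: near_def)
      then show ?thesis using 4 by blast
    qed
  qed
  moreover have "dominating_set T ?S"
    using D Y h E_V unfolding dominating_set_def by blast
  ultimately have "semitotal_dominating_set T ?S" by (simp add: semitotal_dominating_set_iff)
  then have "semitotal_domination_number T \<le> card ?S" by (rule semitotal_domination_number_le)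
  also have "\<dots> \<le> card D + card Y + card (h ` (D - C))"
    by (meson add_le_mono card_Un_le le_trans order_refl)
  also have "card (h ` (D - C)) \<le> card D - card C"
    using C finD by (metis card_Diff_subset card_image_le finite_Diff finite_subset)
  finally show ?thesis using card_mono[OF finD C] by simp
qed

text \<open>Some edge leaves the closed neighborhood of \<open>d\<close>. Its outer end is in
  \<open>D\<close> or is dominated by a vertex of \<open>D\<close>, which cannot be
  \<open>d\<close>.\<close>

lemma neighboring_dominator:
  assumes D: "dominating_set T D" "2 \<le> card D" and d: "d \<in> D"
  shows "\<exists>d'\<in>D. d' \<noteq> d \<and>
    (near T d d' \<or> (\<exists>u v. (d, u) \<in> E \<and> (u, v) \<in> E \<and> (v, d') \<in> E))"
proof -
  let ?N = "insert d {u. (d, u) \<in> E}"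
  have DV: "D \<subseteq> V" using D by (simp add: dominating_set_def)
  obtain t where t: "t \<in> D" "t \<noteq> d"
    using D(2) d finite_dominating_set[OF D(1)]
    by (metis card_le_Suc0_iff_eq not_less_eq_eq numeral_2_eq_2)
  show ?thesis
  proof (cases "t \<in> ?N")
    case True then show ?thesis using t by (auto simp: near_def)
  next
    case False
    obtain u v where uv: "(u, v) \<in> E" "u \<in> ?N" "v \<notin> ?N"
      using cut_edge[of d ?N t] False t DV d E_V by blast
    then have u: "(d, u) \<in> E" by auto
    show ?thesis
    proof (cases "v \<in> D")
      case True then show ?thesis using uv u by (auto simp: near_def)
    next
      case False
      then obtain d' where "d' \<in> D" "(v, d') \<in> E"
        using D(1) E_V(2)[OF uv(1)] unfolding dominating_set_def by blast
      moreover have "d' \<noteq> d" using calculation uv E_sym by blast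
      ultimately show ?thesis using uv u by blast
    qed
  qed
qed

text \<open>With \<open>C = {d, d'}\<close> two vertices are saved; if the two are not near each
  other, a first inner vertex \<open>u\<close> of a path between them serves both at the cost of
  one.\<close>

lemma semitotal_le:
  assumes D: "dominating_set T D" "2 \<le> card D"
  shows "semitotal_domination_number T + 1 \<le> 2 * card D"
proof -
  have DV: "D \<subseteq> V" using D by (simp add: dominating_set_def)
  obtain d where d: "d \<in> D" using D by fastforce
  obtain d' where d': "d' \<in> D" "d' \<noteq> d"
    "near T d d' \<or> (\<exists>u v. (d, u) \<in> E \<and> (u, v) \<in> E \<and> (v, d') \<in> E)"
    using neighboring_dominator[OF D d] by blast
  have C: "{d, d'} \<subseteq> D" "card {d, d'} = 2" using d d' by auto
  show ?thesis
  proof (cases "near T d d'")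
    case True
    have "semitotal_domination_number T + card {d, d'} \<le> 2 * card D + card ({} :: 'a set)"
      by (rule semitotal_domination_number_saving[OF D(1) C(1)]) (use True near_sym[OF True] d d' in auto)
    then show ?thesis using C by simp
  next
    case False
    then obtain u v where uv: "(d, u) \<in> E" "(u, v) \<in> E" "(v, d') \<in> E" using d' by blast
    then have "near T d u" "near T u d'" "u \<noteq> d" "u \<noteq> d'"
      using False E_irrefl by (auto simp: near_def)
    moreover from this have "near T d' u" by (simp add: near_sym)
    ultimately have "semitotal_domination_number T + card {d, d'} \<le> 2 * card D + card {u}"
      using E_V(2)[OF uv(1)] d d' by (intro semitotal_domination_number_saving[OF D(1) C(1)]) auto
    then show ?thesis using C by simp
  qed
qed

end

locale nonstar_tree = nontrivial_tree +
  assumes not_star: "\<not> is_star T"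
begin

text \<open>If \<open>c\<close> alone dominates, an edge avoiding \<open>c\<close> would close a
  triangle with \<open>c\<close>, so the tree is a star.\<close>

lemma dominating_set_card_ge_2:
  assumes D: "dominating_set T D"
  shows "2 \<le> card D"
proof (rule ccontr)
  assume "\<not> 2 \<le> card D"
  moreover have "finite D" using D by (rule finite_dominating_set)
  moreover have "D \<noteq> {}"
    using D card_V by (force simp: dominating_set_def)
  ultimately have "card D = 1" by (metis One_nat_def Suc_leI card_gt_0_iff le_antisym not_less_eq_eq numeral_2_eq_2)
  then obtain c where c: "D = {c}" by (rule card_1_singletonE)
  have cE: "(v, c) \<in> E" if "v \<in> V - {c}" for v
    using D c that by (auto simp: dominating_set_def)
  have cV: "c \<in> V" using D c by (auto simp: dominating_set_def)
  have no: "(u, v) \<notin> E" if "u \<noteq> c" "v \<noteq> c" for u v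
  proof
    assume uv: "(u, v) \<in> E"
    then have "(u, c) \<in> E" "(v, c) \<in> E" using cE E_V that by auto
    then show False using no_cycle[of u "[v, c]"] uv that E_sym E_irrefl by auto
  qed
  have "E = {c} \<times> (V - {c}) \<union> (V - {c}) \<times> {c}"
    using cE no E_sym E_irrefl E_V by auto metis+
  moreover have "V - {c} \<noteq> {}"
  proof
    assume "V - {c} = {}"
    then have "V = {c}" using cV by blast
    then show False using card_V by simp
  qed
  ultimately have "is_star T" unfolding is_star_def using finite_V cV
    by (intro exI[of _ c] exI[of _ "V - {c}"]) auto
  then show False using not_star by simp
qed

end

section \<open>Trees attaining the bound\<close>

text \<open>Combined with the upper bound, \<open>tight\<close> forces \<open>D\<close> to be a
  minimum dominating set and equality to hold.\<close>

locale tight_tree = nonstar_tree +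
  fixes D :: "'a set"
  assumes D: "dominating_set T D"
    and tight: "2 * card D \<le> semitotal_domination_number T + 1"
begin

lemma D_V: "d \<in> D \<Longrightarrow> d \<in> V"
  using D by (auto simp: dominating_set_def)

text \<open>Used for contradictions: a net saving of two over \<open>2 * card D\<close> is
  impossible. \<open>D'\<close> may differ from \<open>D\<close>, since the leaf arguments modify
  the dominating set.\<close>

lemma no_saving:
  assumes "dominating_set T D'" "C \<subseteq> D'" "Y \<subseteq> V" "finite Y"
    and "\<And>c. c \<in> C \<Longrightarrow> \<exists>y\<in>D' \<union> Y. y \<noteq> c \<and> near T c y"
    and "\<And>y. y \<in> Y \<Longrightarrow> \<exists>d\<in>D'. d \<noteq> y \<and> near T y d"
  shows "card C + 2 * card D \<le> 2 * card D' + card Y + 1"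
  using semitotal_domination_number_saving[OF assms] tight by linarith

section \<open>Distances between vertices of \<open>D\<close>\<close>

lemma not_near:
  assumes "d \<in> D" "d' \<in> D" "d \<noteq> d'"
  shows "\<not> near T d d'"
proof
  assume *: "near T d d'"
  have "card {d, d'} + 2 * card D \<le> 2 * card D + card ({} :: 'a set) + 1"
    by (rule no_saving[OF D]) (use * near_sym[OF *] assms in auto)
  then show False using assms by simp
qed

lemma not_adjacent: "d \<in> D \<Longrightarrow> d' \<in> D \<Longrightarrow> (d, d') \<notin> E"
  using not_near[of d d'] E_irrefl by (cases "d = d'") (auto simp: near_def)

lemma dominator_unique:
  assumes "d \<in> D" "d' \<in> D" "(x, d) \<in> E" "(x, d') \<in> E"
  shows "d = d'"
  using not_near[of d d'] assms E_sym unfolding near_def by blast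

text \<open>A walk of length 3. Distinct vertices of \<open>D\<close> are never near, so for them it
  means distance exactly 3.\<close>

definition link :: "'a \<Rightarrow> 'a \<Rightarrow> bool" where
  "link d d' \<longleftrightarrow> (\<exists>u v. (d, u) \<in> E \<and> (u, v) \<in> E \<and> (v, d') \<in> E)"

lemma link_sym: "link d d' \<Longrightarrow> link d' d"
  unfolding link_def using E_sym by blast

lemma link_exists:
  assumes "d \<in> D"
  shows "\<exists>d'\<in>D. d' \<noteq> d \<and> link d d'"
  using neighboring_dominator[OF D dominating_set_card_ge_2[OF D] assms] not_near[OF assms]
  unfolding link_def by blast

lemma shared_witness:
  assumes "d \<in> D" "d' \<in> D" "(d, u) \<in> E" "(u, v) \<in> E" "(v, d') \<in> E"
  shows "u \<in> V" "u \<notin> D" "near T d u" "near T u d" "near T d' u"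
  using assms E_V E_sym not_adjacent unfolding near_def by blast+

text \<open>Each of two disjoint links gets its own shared witness: four vertices are saved at the
  cost of at most two.\<close>

lemma links_intersect:
  assumes "link d1 d2" "link d3 d4" "distinct [d1, d2, d3, d4]" "{d1, d2, d3, d4} \<subseteq> D"
  shows False
proof -
  have m: "d1 \<in> D" "d2 \<in> D" "d3 \<in> D" "d4 \<in> D" using assms(4) by auto
  obtain u v where 1: "(d1, u) \<in> E" "(u, v) \<in> E" "(v, d2) \<in> E" using assms by (auto simp: link_def)
  obtain u' v' where 2: "(d3, u') \<in> E" "(u', v') \<in> E" "(v', d4) \<in> E"
    using assms by (auto simp: link_def)
  note w = shared_witness[OF m(1,2) 1] shared_witness[OF m(3,4) 2]
  have "card {d1, d2, d3, d4} + 2 * card D \<le> 2 * card D + card {u, u'} + 1"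
  proof (rule no_saving[OF D assms(4)])
    show "\<exists>y\<in>D \<union> {u, u'}. y \<noteq> c \<and> near T c y" if "c \<in> {d1, d2, d3, d4}" for c
      using that w m by auto
    show "\<exists>d\<in>D. d \<noteq> y \<and> near T y d" if "y \<in> {u, u'}" for y
      using that w m by auto
  qed (use w in auto)
  moreover have "card {u, u'} \<le> 2" by (simp add: card_insert_if)
  ultimately show False using assms(3) by simp
qed

text \<open>The common neighbor \<open>u\<close> would be a witness for all three vertices: three
  are saved at the cost of one.\<close>

lemma no_shared_exit:
  assumes m: "d \<in> D" "d1 \<in> D" "d2 \<in> D" "distinct [d, d1, d2]"
    and 1: "(d, u) \<in> E" "(u, v) \<in> E" "(v, d1) \<in> E"
    and 2: "(u, v') \<in> E" "(v', d2) \<in> E"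
  shows False
proof -
  note w = shared_witness[OF m(1,2) 1] shared_witness[OF m(1,3) 1(1) 2]
  have "card {d, d1, d2} + 2 * card D \<le> 2 * card D + card {u} + 1"
  proof (rule no_saving[OF D])
    show "\<exists>y\<in>D \<union> {u}. y \<noteq> c \<and> near T c y" if "c \<in> {d, d1, d2}" for c
      using that w m by auto
    show "\<exists>d\<in>D. d \<noteq> y \<and> near T y d" if "y \<in> {u}" for y
      using that w m by auto
  qed (use w m in auto)
  then show False using m(4) by simp
qed

lemma no_link_triangle:
  assumes m: "d1 \<in> D" "d2 \<in> D" "d3 \<in> D" "distinct [d1, d2, d3]"
    and "link d1 d2" "link d2 d3" "link d3 d1"
  shows False
proof -
  obtain u1 v1 where 1: "(d1, u1) \<in> E" "(u1, v1) \<in> E" "(v1, d2) \<in> E"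
    using assms by (auto simp: link_def)
  obtain u2 v2 where 2: "(d2, u2) \<in> E" "(u2, v2) \<in> E" "(v2, d3) \<in> E"
    using assms by (auto simp: link_def)
  obtain u3 v3 where 3: "(d3, u3) \<in> E" "(u3, v3) \<in> E" "(v3, d1) \<in> E"
    using assms by (auto simp: link_def)
  \<comment> \<open>These are the pairs of inner vertices with the same dominator; all other pairs
    differ by \<open>dominator_unique\<close>.\<close>
  have s: "u1 \<noteq> v3" "u2 \<noteq> v1" "u3 \<noteq> v2"
    using no_shared_exit[of d1 d2 d3 u1 v1 u3] no_shared_exit[of d2 d3 d1 u2 v2 u1]
      no_shared_exit[of d3 d1 d2 u3 v3 u2] m 1 2 3 E_sym by auto
  have nD: "x \<notin> D" if "x \<in> {u1, v1, u2, v2, u3, v3}" for x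
    using that 1 2 3 m not_adjacent by blast
  have "u1 \<notin> {v1, u2, v2, u3}" "v3 \<notin> {v1, u2, v2, u3}" "v1 \<notin> {v2, u3}" "u2 \<notin> {v2, u3}"
    using dominator_unique[OF m(1,2)] dominator_unique[OF m(2,3)] dominator_unique[OF m(1,3)]
      m(4) 1 2 3 E_sym[OF 1(1)] E_sym[OF 2(1)] E_sym[OF 3(1)] by auto
  then have "distinct (d1 # [u1, v1, d2, u2, v2, d3, u3, v3])"
    using s nD m by auto
  then show False
    using no_cycle[of d1 "[u1, v1, d2, u2, v2, d3, u3, v3]"] 1 2 3 by simp
qed

text \<open>Links meet pairwise, cover \<open>D\<close> and contain no triangle, which leaves only a
  star.\<close>

lemma link_star:
  obtains a where "a \<in> D" "\<And>b. b \<in> D \<Longrightarrow> b \<noteq> a \<Longrightarrow> link a b"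
    "\<And>b c. b \<in> D \<Longrightarrow> c \<in> D \<Longrightarrow> b \<noteq> c \<Longrightarrow> link b c \<Longrightarrow> b = a \<or> c = a"
proof -
  have "D \<noteq> {}" using dominating_set_card_ge_2[OF D] by auto
  then obtain x y where xy: "x \<in> D" "y \<in> D" "x \<noteq> y" "link x y" using link_exists by blast
  have meet: "{b, c} \<inter> {b', c'} \<noteq> {}"
    if "b \<in> D" "c \<in> D" "b \<noteq> c" "link b c" "b' \<in> D" "c' \<in> D" "b' \<noteq> c'" "link b' c'" for b c b' c'
    using links_intersect[of b c b' c'] that by auto
  show ?thesis
  proof (cases "D = {x, y}")
    case True
    \<comment> \<open>With a single link, either end can be the center.\<close>
    then show ?thesis using that[of x] xy link_sym by auto
  next
    case False
    then obtain z where z: "z \<in> D" "z \<noteq> x" "z \<noteq> y" using xy by blast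
    obtain z' where z': "z' \<in> D" "z' \<noteq> z" "link z z'" using link_exists[OF z(1)] by blast
    have "z' = x \<or> z' = y" using meet[OF xy z(1) z'(1)] z z' by auto
    \<comment> \<open>The center \<open>a\<close> is the common end of the link
      \<open>x\<close>-\<open>y\<close> and a link at \<open>z\<close>.\<close>
    then obtain a b where ab: "a \<in> D" "b \<in> D" "a \<noteq> b" "link a b" "z \<noteq> a" "z \<noteq> b" "link a z"
      using xy z z' link_sym by metis
    have adj: "link a c" if c: "c \<in> D" "c \<noteq> a" for c
    proof (cases "c = b \<or> c = z")
      case True then show ?thesis using ab by auto
    next
      case False
      obtain c' where c': "c' \<in> D" "c' \<noteq> c" "link c c'" using link_exists[OF c(1)] by blast
      \<comment> \<open>A link at \<open>c\<close> must meet both \<open>{a, b}\<close> and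
        \<open>{a, z}\<close>, while \<open>c\<close> lies in neither.\<close>
      have "c' = a"
        using meet[OF ab(1-4) c(1) c'(1)] meet[OF ab(1) z(1) ab(5)[symmetric] ab(7) c(1) c'(1)]
          c c' False ab by auto
      then show ?thesis using c' link_sym by blast
    qed
    moreover have "c = a \<or> c' = a" if c: "c \<in> D" "c' \<in> D" "c \<noteq> c'" "link c c'" for c c'
    proof (rule ccontr)
      assume "\<not> (c = a \<or> c' = a)"
      then show False
        using no_link_triangle[of a c c'] c ab(1) adj link_sym by auto
    qed
    ultimately show ?thesis using that[OF ab(1)] by blast
  qed
qed

end

section \<open>Spiders as members of the family\<close>

lemma spider_in_labeled_family:
  assumes "finite B" "B \<noteq> {}"
    and "\<And>b. b \<in> B \<Longrightarrow> distinct [la, a, p b, q b, b, l b]"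
    and "\<And>b c. b \<in> B \<Longrightarrow> c \<in> B \<Longrightarrow> b \<noteq> c \<Longrightarrow> {p b, q b, b, l b} \<inter> {p c, q c, c, l c} = {}"
    and "S la = Status_C" "S a = Status_A"
    and "\<And>b. b \<in> B \<Longrightarrow> S (p b) = Status_D \<and> S (q b) = Status_E \<and> S b = Status_B \<and> S (l b) = Status_C"
  shows "(\<lparr>pverts = {la, a} \<union> (\<Union>b\<in>B. {p b, q b, b, l b}),
      parcs = undirected ({(la, a)} \<union> (\<Union>b\<in>B. {(p b, a), (p b, q b), (q b, b), (b, l b)}))\<rparr>, S)
    \<in> labeled_family"
  using assms
proof (induction B rule: finite_ne_induct)
  \<comment> \<open>The first leg, with \<open>a\<close> and \<open>la\<close>, is the labeled path
    \<open>P_6\<close>; every further leg is an application of \<open>op2\<close> at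
    \<open>a\<close>.\<close>
  case (singleton b)
  have "(\<lparr>pverts = {la, a, p b, q b, b, l b},
      parcs = undirected {(la, a), (a, p b), (p b, q b), (q b, b), (b, l b)}\<rparr>, S) \<in> labeled_family"
    using singleton.prems by (intro labeled_family.base) auto
  moreover have "undirected {(la, a), (a, p b), (p b, q b), (q b, b), (b, l b)} =
      undirected ({(la, a)} \<union> (\<Union>b\<in>{b}. {(p b, a), (p b, q b), (q b, b), (b, l b)}))"
    by (auto simp: undirected_def)
  moreover have "{la, a, p b, q b, b, l b} = {la, a} \<union> (\<Union>b\<in>{b}. {p b, q b, b, l b})" by auto
  ultimately show ?case by (simp only:)
next
  case (insert b B)
  let ?V = "\<lambda>B. {la, a} \<union> (\<Union>b\<in>B. {p b, q b, b, l b})"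
  let ?E = "\<lambda>B. undirected ({(la, a)} \<union> (\<Union>b\<in>B. {(p b, a), (p b, q b), (q b, b), (b, l b)}))"
  let ?T = "\<lparr>pverts = ?V B, parcs = ?E B\<rparr>"
  have IH: "(?T, S) \<in> labeled_family"
    using insert.prems by (intro insert.IH) blast+
  have "(\<lparr>pverts = pverts ?T \<union> {p b, q b, b, l b},
      parcs = parcs ?T \<union> undirected {(p b, a), (p b, q b), (q b, b), (b, l b)}\<rparr>,
      S(p b := Status_D, q b := Status_E, b := Status_B, l b := Status_C)) \<in> labeled_family"
  proof (rule labeled_family.op2[OF IH])
    show "a \<in> pverts ?T" by simp
    show "S a = Status_A" by fact
    show "distinct [p b, q b, b, l b]" using insert.prems(1)[of b] by simp
    have "{p b, q b, b, l b} \<inter> {p c, q c, c, l c} = {}" if "c \<in> B" for c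
      by (rule insert.prems(2)) (use insert.hyps that in auto)
    then show "{p b, q b, b, l b} \<inter> pverts ?T = {}"
      using insert.prems(1)[of b] by (simp add: Int_Un_distrib Int_UN_distrib)
  qed
  \<comment> \<open>\<open>S\<close> carries the final statuses from the start, so the updates made
    by the operation do nothing.\<close>
  moreover have "S(p b := Status_D, q b := Status_E, b := Status_B, l b := Status_C) = S"
    using insert.prems(5)[of b] by auto
  moreover have "?V (insert b B) = ?V B \<union> {p b, q b, b, l b}" by auto
  moreover have "?E (insert b B) = ?E B \<union> undirected {(p b, a), (p b, q b), (q b, b), (b, l b)}"
    by (auto simp: undirected_def)
  ultimately show ?case by simp
qed

lemma add_leaves_in_labeled_family:
  assumes "finite L" "(\<lparr>pverts = W, parcs = F\<rparr>, S) \<in> labeled_family" "L \<inter> W = {}"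
    and "\<And>x. x \<in> L \<Longrightarrow> S x = Status_C \<and> h x \<in> W \<and> S (h x) \<in> {Status_A, Status_B}"
  shows "(\<lparr>pverts = W \<union> L, parcs = F \<union> undirected ((\<lambda>x. (x, h x)) ` L)\<rparr>, S) \<in> labeled_family"
  using assms
proof (induction L rule: finite_induct)
  case empty
  then show ?case by (simp add: undirected_def)
next
  case (insert x L)
  let ?T = "\<lparr>pverts = W \<union> L, parcs = F \<union> undirected ((\<lambda>x. (x, h x)) ` L)\<rparr>"
  have IH: "(?T, S) \<in> labeled_family" using insert by auto
  have "(\<lparr>pverts = pverts ?T \<union> {x}, parcs = parcs ?T \<union> undirected {(x, h x)}\<rparr>, S(x := Status_C))
      \<in> labeled_family"
    by (rule labeled_family.op1[OF IH]) (use insert in auto)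
  moreover have "S(x := Status_C) = S" using insert.prems(3)[of x] by auto
  moreover have "F \<union> undirected ((\<lambda>x. (x, h x)) ` insert x L) = parcs ?T \<union> undirected {(x, h x)}"
    by (auto simp: undirected_def)
  ultimately show ?case by simp
qed

section \<open>A tight tree is a spider with extra leaves\<close>

locale star_tree = tight_tree +
  fixes a :: 'a and p q :: "'a \<Rightarrow> 'a"
  assumes a: "a \<in> D"
    and leg: "b \<in> D - {a} \<Longrightarrow> (a, p b) \<in> E \<and> (p b, q b) \<in> E \<and> (q b, b) \<in> E"
    and center: "b \<in> D \<Longrightarrow> c \<in> D \<Longrightarrow> b \<noteq> c \<Longrightarrow> link b c \<Longrightarrow> b = a \<or> c = a"
begin

abbreviation "B \<equiv> D - {a}"

lemma finite_D: "finite D" using D by (rule finite_dominating_set)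

lemma B_nonempty: "B \<noteq> {}"
proof
  assume "B = {}"
  then have "D = {a}" using a by blast
  then show False using dominating_set_card_ge_2[OF D] by simp
qed

lemma card_D: "card D = card B + 1"
  using a finite_D by (metis Suc_eq_plus1 card_Suc_Diff1)

lemma legE:
  assumes "b \<in> B"
  shows "(a, p b) \<in> E" "(p b, q b) \<in> E" "(q b, b) \<in> E"
    "(p b, a) \<in> E" "(q b, p b) \<in> E" "(b, q b) \<in> E"
  using leg[OF assms] E_sym by auto

lemma dominator_exists: "v \<in> V \<Longrightarrow> v \<notin> D \<Longrightarrow> \<exists>d\<in>D. (v, d) \<in> E"
  using D by (auto simp: dominating_set_def)

lemma p_inj:
  assumes "b \<in> B" "c \<in> B" "b \<noteq> c"
  shows "p b \<noteq> p c"
  using no_shared_exit[of a b c "p b" "q b" "q c"] assms a legE[OF assms(1)] legE[OF assms(2)] by auto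

lemma not_in_D: "b \<in> B \<Longrightarrow> p b \<notin> D" "b \<in> B \<Longrightarrow> q b \<notin> D"
  using legE not_adjacent a by blast+

text \<open>A second path of length 3 from \<open>a\<close> to \<open>b\<close> closes a cycle: of
  length 4 if it shares one inner vertex with the leg, of length 6 if it shares none.\<close>

lemma cross_edge_unique:
  assumes b: "b \<in> B" and uv: "(a, u) \<in> E" "(u, v) \<in> E" "(v, b) \<in> E"
  shows "u = p b \<and> v = q b"
proof -
  note e = legE[OF b] uv uv[THEN E_sym]
  have D: "u \<notin> D" "v \<notin> D" "p b \<notin> D" "q b \<notin> D"
    using not_in_D[OF b] e a b not_adjacent by blast+
  have ne: "x \<noteq> y" if "(x, a) \<in> E" "(y, b) \<in> E" for x y
    using dominator_unique[of a b x] that a b by auto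
  have ne': "u \<noteq> v" "u \<noteq> q b" "p b \<noteq> v" "p b \<noteq> q b" using ne e by blast+
  have ab: "a \<in> D" "b \<in> D" "a \<noteq> b" using a b by auto
  show ?thesis
  proof (rule ccontr)
    assume "\<not> ?thesis"
    then consider "u = p b" "v \<noteq> q b" | "u \<noteq> p b" "v = q b" | "u \<noteq> p b" "v \<noteq> q b" by blast
    then show False
    proof cases
      case 1
      have "distinct (p b # [v, b, q b])" using 1 D ne' ab by auto
      then show False using no_cycle[of "p b" "[v, b, q b]"] e 1 by simp
    next
      case 2
      have "distinct (a # [u, v, p b])" using 2 D ne' ab by auto
      then show False using no_cycle[of a "[u, v, p b]"] e 2 by simp
    next
      case 3
      have "distinct (a # [u, v, b, q b, p b])" using 3 D ne' ab by auto
      then show False using no_cycle[of a "[u, v, b, q b, p b]"] e 3 by simp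
    qed
  qed
qed

text \<open>The dominators of the two ends differ, since a common one would give a triangle. Hence
  the edge is the middle of a link, and by \<open>center\<close> one end of that link is
  \<open>a\<close>.\<close>

lemma cross_edge:
  assumes uv: "(u, v) \<in> E" "u \<notin> D" "v \<notin> D"
  shows "\<exists>b\<in>B. (u, v) = (p b, q b) \<or> (u, v) = (q b, p b)"
proof -
  obtain d where d: "d \<in> D" "(u, d) \<in> E" using dominator_exists uv E_V by blast
  obtain d' where d': "d' \<in> D" "(v, d') \<in> E" using dominator_exists uv E_V by blast
  have s: "(d, u) \<in> E" "(d', v) \<in> E" "(v, u) \<in> E" using d d' uv E_sym by auto
  have "d \<noteq> d'"
  proof
    assume "d = d'"
    moreover have "u \<noteq> v" using uv E_irrefl by auto
    ultimately show False using no_cycle[of d "[u, v]"] d d' uv s by auto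
  qed
  then have "d = a \<or> d' = a" using center d d' s uv unfolding link_def by blast
  then show ?thesis
  proof
    assume "d = a"
    then have "d' \<in> B" using d' \<open>d \<noteq> d'\<close> by auto
    then show ?thesis using cross_edge_unique[of d' u v] \<open>d = a\<close> s uv d' by auto
  next
    assume "d' = a"
    then have "d \<in> B" using d \<open>d \<noteq> d'\<close> by auto
    then show ?thesis using cross_edge_unique[of d v u] \<open>d' = a\<close> s uv d by auto
  qed
qed

text \<open>Otherwise the vertices \<open>b\<close> and \<open>p b\<close> already form a semitotal dominating set.\<close>
lemma center_leaf: "\<exists>l. (a, l) \<in> E \<and> l \<notin> p ` B"
proof (rule ccontr)
  assume no: "\<nexists>l. (a, l) \<in> E \<and> l \<notin> p ` B"
  let ?D = "B \<union> p ` B"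
  have "dominating_set T ?D"
    unfolding dominating_set_def
  proof (intro conjI ballI)
    show "?D \<subseteq> V" using D_V E_V(2)[OF legE(1)] by auto
    fix v assume v: "v \<in> V - ?D"
    show "\<exists>d\<in>?D. (v, d) \<in> E"
    proof (cases "v = a")
      case True
      then show ?thesis using B_nonempty legE(1) by blast
    next
      case False
      then obtain d where d: "d \<in> D" "(v, d) \<in> E" using dominator_exists v by blast
      then have "d \<noteq> a" using no v E_sym by blast
      then show ?thesis using d by blast
    qed
  qed
  \<comment> \<open>Every vertex of \<open>?D\<close> has its witness in \<open>?D\<close>, so
    \<open>C\<close> is all of \<open>?D\<close>. The result
    \<open>2 * card D \<le> card ?D + 1\<close> contradicts
    \<open>card ?D \<le> 2 * card B\<close>.\<close>
  then have "card ?D + 2 * card D \<le> 2 * card ?D + card ({} :: 'a set) + 1"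
  proof (rule no_saving)
    fix c assume "c \<in> ?D"
    then consider "c \<in> B" | b where "b \<in> B" "c = p b" by blast
    then show "\<exists>y\<in>?D \<union> {}. y \<noteq> c \<and> near T c y"
    proof cases
      case 1
      then have "p c \<in> ?D" "p c \<noteq> c" "near T c (p c)"
        using not_in_D(1)[OF 1] legE[OF 1] by (auto simp: near_def)
      then show ?thesis by blast
    next
      case 2
      then have "b \<in> ?D" "b \<noteq> c" "near T c b"
        using not_in_D(1)[OF 2(1)] legE[OF 2(1)] by (auto simp: near_def)
      then show ?thesis by blast
    qed
  qed auto
  moreover have "card ?D \<le> card B + card B"
    using card_Un_le[of B "p ` B"] card_image_le[of B p] finite_D by simp
  ultimately show False using card_D by simp
qed

text \<open>Otherwise \<open>q b\<close> can replace \<open>b\<close> in \<open>D\<close>, and \<open>q b\<close> is within distance 2 of \<open>a\<close>.\<close>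
lemma leg_leaf:
  assumes b: "b \<in> B"
  shows "\<exists>l. (b, l) \<in> E \<and> l \<noteq> q b"
proof (rule ccontr)
  assume no: "\<nexists>l. (b, l) \<in> E \<and> l \<noteq> q b"
  let ?D = "insert (q b) (D - {b})"
  note e = legE[OF b]
  have "dominating_set T ?D"
    unfolding dominating_set_def
  proof (intro conjI ballI)
    show "?D \<subseteq> V" using D_V E_V(2)[OF e(2)] by auto
    fix v assume v: "v \<in> V - ?D"
    show "\<exists>d\<in>?D. (v, d) \<in> E"
    proof (cases "v = b")
      case True
      then show ?thesis using e by blast
    next
      case False
      then obtain d where d: "d \<in> D" "(v, d) \<in> E" using dominator_exists v by blast
      then have "d \<noteq> b" using no v E_sym by blast
      then show ?thesis using d by blast
    qed
  qed
  \<comment> \<open>The exchange keeps the size, while \<open>a\<close> and \<open>q b\<close> now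
    serve each other: a saving of two.\<close>
  then have "card {a, q b} + 2 * card D \<le> 2 * card ?D + card ({} :: 'a set) + 1"
  proof (rule no_saving)
    have "near T (q b) a" "q b \<noteq> a" "a \<in> D - {b}" using b e a not_in_D(2)[OF b] by (auto simp: near_def)
    moreover from this have "near T a (q b)" by (simp add: near_sym)
    ultimately have "\<exists>y\<in>?D. y \<noteq> a \<and> near T a y" "\<exists>y\<in>?D. y \<noteq> q b \<and> near T (q b) y"
      by (metis insertI1, metis insertI2)
    then show "\<exists>y\<in>?D \<union> {}. y \<noteq> c \<and> near T c y" if "c \<in> {a, q b}" for c
      using that by auto
  qed (use a b in auto)
  moreover have "card ?D = card D" using b finite_D not_in_D(2)[OF b]
    by (simp add: card.insert_remove) (metis card_gt_0_iff emptyE Suc_pred)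
  moreover have "a \<noteq> q b" using a not_in_D(2)[OF b] by blast
  ultimately show False by simp
qed

text \<open>Below, \<open>la\<close> and \<open>l b\<close> are the leaves of the spider built by the base case and the second
  operation; all other leaves, joined to their dominator \<open>h\<close>, come from the first operation.\<close>
lemma labeling_exists: "\<exists>S. (T, S) \<in> labeled_family"
proof -
  obtain la where la: "(a, la) \<in> E" "la \<notin> p ` B" using center_leaf by blast
  have "\<forall>b\<in>B. \<exists>l. (b, l) \<in> E \<and> l \<noteq> q b" using leg_leaf by blast
  then obtain l where l: "\<And>b. b \<in> B \<Longrightarrow> (b, l b) \<in> E \<and> l b \<noteq> q b" by metis
  have "\<forall>v\<in>V - D. \<exists>d. d \<in> D \<and> (v, d) \<in> E" using dominator_exists by blast
  then obtain h where h: "\<And>v. v \<in> V - D \<Longrightarrow> h v \<in> D \<and> (v, h v) \<in> E" by metis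
  \<comment> \<open>Dominators are unique, so \<open>h\<close> is forced. Different values of
    \<open>h\<close> are then the main way to tell spider vertices apart.\<close>
  have h_eq: "h x = d" if "d \<in> D" "(x, d) \<in> E" for x d
  proof -
    have "x \<in> V - D" using that E_V not_adjacent by blast
    then show ?thesis using h dominator_unique that by blast
  qed
  have nD: "la \<notin> D" "\<And>b. b \<in> B \<Longrightarrow> l b \<notin> D" using la l a not_adjacent by blast+
  have hs: "h la = a" "\<And>b. b \<in> B \<Longrightarrow> h (p b) = a" "\<And>b. b \<in> B \<Longrightarrow> h (q b) = b"
    "\<And>b. b \<in> B \<Longrightarrow> h (l b) = b"
    using h_eq la l legE a E_sym by auto
  define S where "S v = (if v = a then Status_A else if v \<in> B then Status_B
    else if v \<in> p ` B then Status_D else if v \<in> q ` B then Status_E else Status_C)" for v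
  have nq: "la \<notin> q ` B" "\<And>b. b \<in> B \<Longrightarrow> q b \<notin> p ` B"
    "\<And>b. b \<in> B \<Longrightarrow> l b \<notin> p ` B" "\<And>b. b \<in> B \<Longrightarrow> l b \<notin> q ` B"
  proof -
    have q: "x \<notin> q ` B" if "h x = a" for x using hs(3) that by (metis DiffE imageE singletonI)
    have p: "x \<notin> p ` B" if "h x \<noteq> a" for x using hs(2) that by auto
    show "la \<notin> q ` B" using q hs(1) by simp
    fix b assume b: "b \<in> B"
    show "q b \<notin> p ` B" using p hs(3)[OF b] b by simp
    show "l b \<notin> p ` B" using p hs(4)[OF b] b by simp
    show "l b \<notin> q ` B"
    proof
      assume "l b \<in> q ` B"
      then obtain c where "c \<in> B" "l b = q c" by blast
      then show False using hs(3)[of c] hs(4)[OF b] l[OF b] by simp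
    qed
  qed
  let ?V = "{la, a} \<union> (\<Union>b\<in>B. {p b, q b, b, l b})"
  let ?E = "undirected ({(la, a)} \<union> (\<Union>b\<in>B. {(p b, a), (p b, q b), (q b, b), (b, l b)}))"
  let ?L = "V - ?V"
  have core: "(\<lparr>pverts = ?V, parcs = ?E\<rparr>, S) \<in> labeled_family"
  proof (rule spider_in_labeled_family)
    show "distinct [la, a, p b, q b, b, l b]" if b: "b \<in> B" for b
    proof -
      have "\<forall>d\<in>D. la \<noteq> d \<and> p b \<noteq> d \<and> q b \<noteq> d \<and> l b \<noteq> d"
        using nD(1) nD(2)[OF b] not_in_D[OF b] by metis
      then have "la \<noteq> a" "p b \<noteq> a" "q b \<noteq> a" "l b \<noteq> a"
        "la \<noteq> b" "p b \<noteq> b" "q b \<noteq> b" "l b \<noteq> b" "a \<noteq> b"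
        using a b by auto
      moreover have "la \<noteq> q b" "la \<noteq> l b" "p b \<noteq> q b" "p b \<noteq> l b"
        using hs(1) hs(2-4)[OF b] \<open>a \<noteq> b\<close> by metis+
      moreover have "la \<noteq> p b" "l b \<noteq> q b" using la l[OF b] b by auto
      ultimately show ?thesis by auto
    qed
    show "{p b, q b, b, l b} \<inter> {p c, q c, c, l c} = {}" if bc: "b \<in> B" "c \<in> B" "b \<noteq> c" for b c
    proof -
      have "\<forall>d\<in>D. p x \<noteq> d \<and> q x \<noteq> d \<and> l x \<noteq> d" if "x \<in> B" for x
        using nD(2)[OF that] not_in_D[OF that] by metis
      from this[OF bc(1)] this[OF bc(2)]
      have "p b \<noteq> c" "q b \<noteq> c" "l b \<noteq> c" "p c \<noteq> b" "q c \<noteq> b" "l c \<noteq> b" using bc by auto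
      moreover have "q b \<noteq> p c" "q b \<noteq> q c" "q b \<noteq> l c" "l b \<noteq> p c" "l b \<noteq> q c" "l b \<noteq> l c"
        "p b \<noteq> q c" "p b \<noteq> l c"
        using hs(2-4)[OF bc(1)] hs(2-4)[OF bc(2)] bc by auto
      moreover have "p b \<noteq> p c" using p_inj bc by blast
      ultimately show ?thesis using bc(3) by auto
    qed
    show "S (p b) = Status_D \<and> S (q b) = Status_E \<and> S b = Status_B \<and> S (l b) = Status_C"
      if "b \<in> B" for b
      using that not_in_D[OF that] nD(2)[OF that] nq(2-4)[OF that] a by (auto simp: S_def)
  qed (use finite_D B_nonempty la nq nD a in \<open>auto simp: S_def\<close>)
  have leaves: "S x = Status_C \<and> h x \<in> ?V \<and> S (h x) \<in> {Status_A, Status_B}" if x: "x \<in> ?L" for x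
  proof -
    have "x \<in> V - D" using x by auto
    then have "h x \<in> D" using h by blast
    then show ?thesis using x by (auto simp: S_def)
  qed
  have "(\<lparr>pverts = ?V \<union> ?L, parcs = ?E \<union> undirected ((\<lambda>x. (x, h x)) ` ?L)\<rparr>, S) \<in> labeled_family"
    by (rule add_leaves_in_labeled_family[OF finite_Diff[OF finite_V] core _ leaves]) blast+
  moreover have "V = ?V \<union> ?L"
    using la l legE a D_V E_V by blast
  moreover have "E = ?E \<union> undirected ((\<lambda>x. (x, h x)) ` ?L)" (is "E = ?F")
  proof (intro equalityI subrelI)
    have sym: "(y, x) \<in> ?F" if "(x, y) \<in> ?F" for x y
      using that unfolding undirected_def by blast
    \<comment> \<open>An edge meeting \<open>D\<close> is determined by its end outside
      \<open>D\<close>, as \<open>d = h x\<close>; edges avoiding \<open>D\<close> are the middle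
      edges of legs by \<open>cross_edge\<close>.\<close>
    have D_arc: "(x, d) \<in> ?F" if xd: "(x, d) \<in> E" "d \<in> D" for x d
    proof -
      have d: "d = h x" using h_eq xd by simp
      have x: "x \<in> V" "x \<notin> D" using xd E_V not_adjacent by blast+
      show ?thesis
      proof (cases "x \<in> ?V")
        case False
        then show ?thesis using x d by (auto simp: undirected_def)
      next
        case True
        then consider "x = la" | b where "b \<in> B" "x \<in> {p b, q b, l b}" using x a by blast
        then show ?thesis
        proof cases
          case 1 then show ?thesis using hs(1) d by (simp add: undirected_def)
        next
          case 2 then show ?thesis using hs(2-4)[OF 2(1)] d by (auto simp: undirected_def)
        qed
      qed
    qed
    fix x y
    show "(x, y) \<in> ?F" if xy: "(x, y) \<in> E"
    proof (cases "x \<in> D \<or> y \<in> D")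
      case True
      then show ?thesis using D_arc[of x y] D_arc[of y x] sym[of y x] xy E_sym[OF xy] by blast
    next
      case False
      then obtain b where "b \<in> B" "(x, y) = (p b, q b) \<or> (x, y) = (q b, p b)"
        using cross_edge xy by blast
      then show ?thesis by (auto simp: undirected_def)
    qed
    have EF: "{(la, a)} \<union> (\<Union>b\<in>B. {(p b, a), (p b, q b), (q b, b), (b, l b)}) \<subseteq> E"
      using la(1) legE l E_sym by blast
    have "(\<lambda>x. (x, h x)) ` ?L \<subseteq> E" using h by auto
    moreover have "undirected R \<subseteq> E" if "R \<subseteq> E" for R
      using that E_sym unfolding undirected_def by blast
    ultimately have "?F \<subseteq> E" using EF by (meson Un_least)
    then show "(x, y) \<in> E" if "(x, y) \<in> ?F" using that by (rule subsetD)
  qed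
  ultimately have "(\<lparr>pverts = V, parcs = E\<rparr>, S) \<in> labeled_family" by simp
  moreover have "\<lparr>pverts = V, parcs = E\<rparr> = T" by simp
  ultimately show ?thesis by metis
qed

end

lemma (in tight_tree) labeling_exists: "\<exists>S. (T, S) \<in> labeled_family"
proof -
  obtain a where a: "a \<in> D" "\<And>b. b \<in> D \<Longrightarrow> b \<noteq> a \<Longrightarrow> link a b"
    "\<And>b c. b \<in> D \<Longrightarrow> c \<in> D \<Longrightarrow> b \<noteq> c \<Longrightarrow> link b c \<Longrightarrow> b = a \<or> c = a"
    by (rule link_star) blast
  then have "\<forall>b\<in>D - {a}. \<exists>u v. (a, u) \<in> E \<and> (u, v) \<in> E \<and> (v, b) \<in> E"
    by (auto simp: link_def)
  then obtain p q where "\<And>b. b \<in> D - {a} \<Longrightarrow> (a, p b) \<in> E \<and> (p b, q b) \<in> E \<and> (q b, b) \<in> E"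
    by metis
  then interpret star_tree T D a p q
    using a by unfold_locales auto
  show ?thesis by (rule labeling_exists)
qed

section \<open>Trees in the family\<close>

text \<open>The parts of the decomposition are the fibers of \<open>g\<close>: the center with its leaves, and each leg
  with the leaves at its \<open>B\<close>-vertex. A part is represented by its vertex of status \<open>A\<close> or \<open>B\<close>.\<close>
locale leg_decomposition =
  fixes T :: "'a pair_pre_digraph" and S :: "'a \<Rightarrow> status" and a :: 'a and g :: "'a \<Rightarrow> 'a"
  assumes finite_verts: "finite (pverts T)"
    and arcs_verts: "(u, v) \<in> parcs T \<Longrightarrow> u \<in> pverts T \<and> v \<in> pverts T"
    and center: "a \<in> pverts T" "S a = Status_A" "g a = a"
    and center_unique: "v \<in> pverts T \<Longrightarrow> S v = Status_A \<Longrightarrow> v = a"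
    and owner_B: "v \<in> pverts T \<Longrightarrow> S v = Status_B \<Longrightarrow> g v = v"
    and arc_B: "(v, u) \<in> parcs T \<Longrightarrow> S v = Status_B \<Longrightarrow> g u = v \<and> S u \<in> {Status_C, Status_E}"
    and owner_C: "v \<in> pverts T \<Longrightarrow> S v = Status_C \<Longrightarrow>
      (v, g v) \<in> parcs T \<and> S (g v) \<in> {Status_A, Status_B}"
    and arc_C: "(v, u) \<in> parcs T \<Longrightarrow> S v = Status_C \<Longrightarrow> u = g v"
    and arc_D: "v \<in> pverts T \<Longrightarrow> S v = Status_D \<Longrightarrow> (v, a) \<in> parcs T"
    and owner_E: "v \<in> pverts T \<Longrightarrow> S v = Status_E \<Longrightarrow> (v, g v) \<in> parcs T \<and> S (g v) = Status_B"
    and arc_E: "(v, u) \<in> parcs T \<Longrightarrow> S v = Status_E \<Longrightarrow> g u = g v"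
    and leaf: "v \<in> pverts T \<Longrightarrow> S v \<in> {Status_A, Status_B} \<Longrightarrow>
      \<exists>u\<in>pverts T. S u = Status_C \<and> g u = v"
begin

abbreviation "B \<equiv> {b \<in> pverts T. S b = Status_B}"

lemma dominating_set: "dominating_set T (insert a B)"
  unfolding dominating_set_def
proof (intro conjI ballI)
  show "insert a B \<subseteq> pverts T" using center by auto
  fix v assume v: "v \<in> pverts T - insert a B"
  show "\<exists>d\<in>insert a B. (v, d) \<in> parcs T"
  proof (cases "S v")
    case Status_C
    then have "(v, g v) \<in> parcs T" "S (g v) \<in> {Status_A, Status_B}" using owner_C v by auto
    then show ?thesis using arcs_verts[of v "g v"] center_unique[of "g v"] by blast
  next
    case Status_E
    then have "(v, g v) \<in> parcs T" "S (g v) = Status_B" using owner_E v by auto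
    then show ?thesis using arcs_verts[of v "g v"] by blast
  qed (use v center_unique arc_D in auto)
qed

text \<open>A leaf at a \<open>B\<close>-vertex puts a vertex of \<open>X\<close> into its leg whose witness cannot leave the leg.\<close>
lemma card_ge:
  assumes dom: "dominating_set T X" and nr: "\<And>x. x \<in> X \<Longrightarrow> \<exists>y\<in>X. y \<noteq> x \<and> near T x y"
  shows "2 * card B + 1 \<le> card X"
proof -
  let ?G = "\<lambda>b. {x \<in> X. g x = b}"
  have XV: "X \<subseteq> pverts T" using dom by (simp add: dominating_set_def)
  have finX: "finite X" using XV finite_verts finite_subset by blast
  \<comment> \<open>The only neighbor of a leaf at \<open>v\<close> is \<open>v\<close>, so
    dominating that leaf puts it or \<open>v\<close> into \<open>X\<close>.\<close>
  have hit: "\<exists>x\<in>X. g x = v \<and> (x = v \<or> S x = Status_C)"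
    if v: "v \<in> pverts T" "S v \<in> {Status_A, Status_B}" for v
  proof -
    obtain c where c: "c \<in> pverts T" "S c = Status_C" "g c = v" using leaf[OF v] by blast
    have "g v = v" using v(2) center(3) center_unique[OF v(1)] owner_B[OF v(1)] by auto
    moreover have "c \<in> X \<or> v \<in> X"
      using dom c arc_C[of c] unfolding dominating_set_def by blast
    ultimately show ?thesis using c by blast
  qed
  have two: "2 \<le> card (?G b)" if b: "b \<in> B" for b
  proof -
    obtain x where x: "x \<in> X" "g x = b" "x = b \<or> S x = Status_C" using hit[of b] b by auto
    obtain y where y: "y \<in> X" "y \<noteq> x" "near T x y" using nr x by blast
    have nb: "g u = b" if "(b, u) \<in> parcs T" for u using arc_B that b by blast
    \<comment> \<open>Two steps from \<open>b\<close> stay in its part: a leaf leads back to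
      \<open>b\<close>, and the neighbors of an \<open>E\<close>-vertex have the same owner.\<close>
    have nnb: "u = b \<or> g u = b" if w: "(b, w) \<in> parcs T" "(w, u) \<in> parcs T" for u w
    proof (cases "S w = Status_C")
      case True then show ?thesis using arc_C[OF w(2)] nb[OF w(1)] by simp
    next
      case False
      then have "S w = Status_E" using arc_B[OF w(1)] b by auto
      then show ?thesis using arc_E[OF w(2)] nb[OF w(1)] by simp
    qed
    have gb: "g b = b" using owner_B b by blast
    have "g y = b"
    proof (cases "x = b")
      case True then show ?thesis using y(3) nb nnb gb unfolding near_def by blast
    next
      case False
      then have "u = b" if "(x, u) \<in> parcs T" for u using arc_C[OF that] x by simp
      then show ?thesis using y(3) nb gb unfolding near_def by blast
    qed
    then have "{x, y} \<subseteq> ?G b" using x y by auto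
    then have "card {x, y} \<le> card (?G b)" using finX by (intro card_mono) auto
    then show ?thesis using y by simp
  qed
  have one: "1 \<le> card (?G a)"
  proof -
    have "?G a \<noteq> {}" using hit[of a] center by blast
    then show ?thesis using finX by (simp add: Suc_leI card_gt_0_iff)
  qed
  have aB: "a \<notin> B" using center by simp
  \<comment> \<open>The fibers of \<open>g\<close> are disjoint: each leg contributes at least two,
    the center at least one.\<close>
  have "2 * card B + 1 \<le> (\<Sum>b\<in>B. card (?G b)) + card (?G a)"
    using sum_bounded_below[of B 2 "\<lambda>b. card (?G b)"] two one by auto
  also have "\<dots> = (\<Sum>b\<in>insert a B. card (?G b))" using aB finite_verts by simp
  also have "\<dots> = card (\<Union>b\<in>insert a B. ?G b)"
    using finX finite_verts by (subst card_UN_disjoint) auto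
  also have "\<dots> \<le> card X" using finX by (intro card_mono) auto
  finally show ?thesis .
qed

end

section \<open>The decomposition for the path and its preservation by the operations\<close>

lemma leg_decomposition_base:
  assumes "S x1 = Status_C" "S x2 = Status_A" "S x3 = Status_D"
    "S x4 = Status_E" "S x5 = Status_B" "S x6 = Status_C"
    "g x1 = x2" "g x2 = x2" "g x3 = x5" "g x4 = x5" "g x5 = x5" "g x6 = x5"
  shows "leg_decomposition \<lparr>pverts = {x1, x2, x3, x4, x5, x6},
      parcs = undirected {(x1, x2), (x2, x3), (x3, x4), (x4, x5), (x5, x6)}\<rparr> S x2 g"
  by (rule leg_decomposition.intro; simp add: undirected_def assms;
      (elim disjE conjE; simp add: assms)?)

lemma leg_decomposition_op1:
  assumes "leg_decomposition T S a g" and v: "v \<in> pverts T" "S v = Status_A \<or> S v = Status_B"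
    and u: "u \<notin> pverts T"
  shows "leg_decomposition \<lparr>pverts = pverts T \<union> {u}, parcs = parcs T \<union> undirected {(u, v)}\<rparr>
    (S(u := Status_C)) a (g(u := v))"
proof -
  interpret leg_decomposition T S a g by fact
  have E: "x \<noteq> u" "y \<noteq> u" if "(x, y) \<in> parcs T" for x y using arcs_verts[OF that] u by auto
  have ne: "v \<noteq> u" "a \<noteq> u" using v u center by auto
  have gE: "g x \<noteq> u" if "x \<in> pverts T" "S x = Status_C \<or> S x = Status_E" for x
    using that owner_C[of x] owner_E[of x] E by blast
  show ?thesis
  \<comment> \<open>Goals follow the order of the locale assumptions: 3 to 5 are
    \<open>center\<close>, 14 is \<open>leaf\<close>. The new leaf \<open>u\<close> joins the part
    of \<open>v\<close>.\<close>
  proof (rule leg_decomposition.intro, goal_cases)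
    case (14 w)
    then have "w \<in> pverts T" "S w \<in> {Status_A, Status_B}" by (auto split: if_splits)
    then obtain c where "c \<in> pverts T" "S c = Status_C" "g c = w" using leaf by blast
    then show ?case using u by (intro bexI[of _ c]) auto
  next
    case 1 show ?case using finite_verts by simp
  next
    case (2 x y) then show ?case using arcs_verts[of x y] v by (auto simp: undirected_def)
  next
    case (6 x) then show ?case using center_unique[of x] by (auto split: if_splits)
  next
    case (7 x) then show ?case using owner_B[of x] by (auto split: if_splits)
  next
    case (8 x y) then show ?case using arc_B[of x y] E[of x y] v owner_B[of x]
      by (auto simp: undirected_def split: if_splits)
  next
    case (9 x)
    show ?case
    proof (cases "x = u")
      case True
      then show ?thesis using v ne by (auto simp: undirected_def)
    next
      case False
      then have x: "x \<in> pverts T" "S x = Status_C" using 9 by auto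
      then show ?thesis using owner_C[OF x] gE[of x] False by auto
    qed
  next
    case (10 x y) then show ?case using arc_C[of x y] E[of x y] v
      by (auto simp: undirected_def split: if_splits)
  next
    case (11 x) then show ?case using arc_D[of x] by (auto split: if_splits)
  next
    case (12 x) then show ?case using owner_E[of x] E[of x "g x"] by (auto split: if_splits)
  next
    case (13 x y) then show ?case using arc_E[of x y] E[of x y] v
      by (auto simp: undirected_def split: if_splits)
  qed (use center ne in auto)
qed

text \<open>The new path is a part of its own, represented by \<open>u3\<close>. Its only edge to
  the old tree joins a \<open>D\<close>-vertex to \<open>a\<close>, and \<open>arc_B\<close>,
  \<open>arc_C\<close> and \<open>arc_E\<close> do not constrain arcs leaving such vertices.\<close>

lemma leg_decomposition_op2:
  assumes "leg_decomposition T S a g"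
    and u: "distinct [u1, u2, u3, u4]" "{u1, u2, u3, u4} \<inter> pverts T = {}"
  shows "leg_decomposition \<lparr>pverts = pverts T \<union> {u1, u2, u3, u4},
      parcs = parcs T \<union> undirected {(u1, a), (u1, u2), (u2, u3), (u3, u4)}\<rparr>
    (S(u1 := Status_D, u2 := Status_E, u3 := Status_B, u4 := Status_C)) a
    (\<lambda>v. if v \<in> {u1, u2, u3, u4} then u3 else g v)"
proof -
  interpret leg_decomposition T S a g by fact
  let ?U = "{u1, u2, u3, u4}"
  have E: "x \<notin> ?U" "y \<notin> ?U" if "(x, y) \<in> parcs T" for x y using arcs_verts[OF that] u by auto
  have ne: "a \<notin> ?U" using u center by auto
  show ?thesis
  proof (rule leg_decomposition.intro, goal_cases)
    case (14 w)
    show ?case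
    proof (cases "w = u3")
      case True
      then show ?thesis by (intro bexI[of _ u4]) auto
    next
      case False
      then have "w \<in> pverts T" "S w \<in> {Status_A, Status_B}" using 14 by (auto split: if_splits)
      then obtain c where "c \<in> pverts T" "S c = Status_C" "g c = w" using leaf by blast
      then show ?thesis using u by (intro bexI[of _ c]) auto
    qed
  next
    case 1 show ?case using finite_verts by simp
  next
    case (2 x y) then show ?case using arcs_verts[of x y] center by (auto simp: undirected_def)
  next
    case (6 x) then show ?case using center_unique[of x] by (auto split: if_splits)
  next
    case (7 x) then show ?case using owner_B[of x] u by (auto split: if_splits)
  next
    case (8 x y) then show ?case using arc_B[of x y] E[of x y] center u ne
      by (auto simp: undirected_def split: if_splits)
  next
    case (9 x) then show ?case using owner_C[of x] E[of x "g x"] u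
      by (auto simp: undirected_def split: if_splits)
  next
    case (10 x y) then show ?case using arc_C[of x y] E[of x y] center u ne
      by (auto simp: undirected_def split: if_splits)
  next
    case (11 x) then show ?case using arc_D[of x] by (auto simp: undirected_def split: if_splits)
  next
    case (12 x) then show ?case using owner_E[of x] E[of x "g x"] u
      by (auto simp: undirected_def split: if_splits)
  next
    case (13 x y) then show ?case using arc_E[of x y] E[of x y] center u ne
      by (auto simp: undirected_def split: if_splits)
  qed (use center ne in auto)
qed

lemma labeled_family_leg_decomposition:
  assumes "(T, S) \<in> labeled_family"
  shows "\<exists>a g. leg_decomposition T S a g"
  using assms
proof (induction rule: labeled_family.induct)
  case (base x1 x2 x3 x4 x5 x6 S)
  have "leg_decomposition \<lparr>pverts = {x1, x2, x3, x4, x5, x6},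
      parcs = undirected {(x1, x2), (x2, x3), (x3, x4), (x4, x5), (x5, x6)}\<rparr> S x2
      (\<lambda>v. if v \<in> {x1, x2} then x2 else x5)"
    by (rule leg_decomposition_base) (use base in auto)
  then show ?case by blast
next
  case (op1 T S v u)
  then obtain a g where *: "leg_decomposition T S a g" by blast
  show ?case using leg_decomposition_op1[OF * op1.hyps(2-4)] by fast
next
  case (op2 T S v u1 u2 u3 u4)
  then obtain a g where *: "leg_decomposition T S a g" by blast
  \<comment> \<open>Neither operation creates a new \<open>A\<close>-vertex, so every leg is
    attached at the same center.\<close>
  have "v = a" by (rule leg_decomposition.center_unique[OF * op2.hyps(2,3)])
  then show ?case using leg_decomposition_op2[OF * op2.hyps(4,5)] by fast
qed

text \<open>With \<open>k\<close> legs, the center and the \<open>B\<close>-vertices dominate with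
  \<open>k + 1\<close> vertices, while any semitotal dominating set has at least
  \<open>2 * k + 1\<close>.\<close>

lemma (in nontrivial_tree) labeled_family_tight:
  assumes "(T, S) \<in> labeled_family"
  shows "2 * domination_number T \<le> semitotal_domination_number T + 1"
proof -
  obtain a g where "leg_decomposition T S a g"
    using labeled_family_leg_decomposition[OF assms] by blast
  then interpret leg: leg_decomposition T S a g .
  obtain X where X: "semitotal_dominating_set T X" "card X = semitotal_domination_number T"
    by (rule minimum_semitotal_dominating_set)
  have "2 * card leg.B + 1 \<le> card X"
    by (rule leg.card_ge) (use X in \<open>auto simp: semitotal_dominating_set_iff\<close>)
  moreover have "domination_number T \<le> card leg.B + 1"
    using domination_number_le[OF leg.dominating_set] leg.finite_verts leg.center
    by (simp add: card_insert_if)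
  ultimately show ?thesis using X by simp
qed

theorem theorem3p1:
  fixes T :: "'a pair_pre_digraph"
  assumes "is_tree T"
    and "card (pverts T) \<ge> 2"
    and "\<not> is_star T"
  shows "int (semitotal_domination_number T) \<le> 2 * int (domination_number T) - 1 \<and>
    (int (semitotal_domination_number T) = 2 * int (domination_number T) - 1 \<longleftrightarrow>
      (\<exists>S :: 'a \<Rightarrow> status. (T, S) \<in> labeled_family))"
proof -
  interpret nonstar_tree T using assms by unfold_locales
  obtain D where D: "dominating_set T D" "card D = domination_number T"
    by (rule minimum_dominating_set)
  have le: "semitotal_domination_number T + 1 \<le> 2 * domination_number T"
    using semitotal_le[OF D(1) dominating_set_card_ge_2[OF D(1)]] D(2) by simp
  have "\<exists>S. (T, S) \<in> labeled_family"
    if "2 * domination_number T \<le> semitotal_domination_number T + 1"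
  proof -
    interpret tight_tree T D using D that by unfold_locales auto
    show ?thesis by (rule labeling_exists)
  qed
  then have "(\<exists>S. (T, S) \<in> labeled_family) \<longleftrightarrow>
      2 * domination_number T \<le> semitotal_domination_number T + 1"
    using labeled_family_tight by blast
  \<comment> \<open>By \<open>le\<close> the inequality in the equivalence is the required
    equality.\<close>
  then show ?thesis using le by auto
qed

end
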